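(* Let $f(n)$ be the number, modulo the action of $S_3$ on the colors, of acceptable flexible color vectors for trees with $n$ internal vertices, and let $r(n)$ be the number, modulo the action of $S_3$ on the colors, of positive rigid color vectors valid for trees with $n$ internal vertices. Then $f(1)=0$, $f(2)=1$ and $f(n+1)=3f(n)+r(n)$ for $n\ge1$.
   Context: Finite binary trees are rooted, planar; every vertex has $0$ or two (ordered: left, right) children except the root $*$, which has degree $1$ and a single child $\emptyset$. A tree with $n$ internal vertices (vertices of degree $3$) has $n+1$ leaves, numbered left to right. Colors are elements of $\mathbb Z_2\times\mathbb Z_2$, coded $0=(0,0)$, $1=(0,1)$, $2=(1,0)$, $3=(1,1)$. A color vector $\mathbf c=(c_1,\dots,c_{n+1})$ for such a tree determines the unique edge coloring in which the edge at the $i$-th leaf has color $c_i$ and the three edges at each internal vertex sum to $0$. It is valid for the tree if this is a proper edge coloring using only colors $1,2,3$; it is acceptable if it is valid for some tree with $n+1$ leaves. A valid color vector gives each internal vertex a derived sign: $+$ if the colors of its (parent edge, left child edge, right child edge) form a cyclic permutation of $(1,2,3)$, and $-$ otherwise. A sign assignment is rigid if any two adjacent internal vertices have opposite signs; it is positive rigid if moreover $\emptyset$ is positive, and flexible if it is not rigid. An acceptable vector is positive rigid (resp. flexible) if its derived sign assignment is so on one (equivalently every) tree for which it is valid. $S_3$ acts by permuting the colors $1,2,3$; $f(n)$ is the number of $S_3$-orbits of flexible acceptable vectors of length $n+1$, and $r(n)$ is the number of $S_3$-orbits containing a positive rigid vector of length $n+1$ (equivalently the number of positive rigid vectors of length $n+1$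 whose entries sum to $1$). *)

theory Defs
  imports "HOL-Library.Z2" "HOL-Library.Product_Plus" "HOL-Library.Tree"
    "HOL-Combinatorics.Permutations"
begin

text \<open>
  The root of degree 1 is left implicit: a tree is represented by the subtree hanging from the
  single child of the root, so that the internal vertices (those of degree 3) are exactly the
  nodes.  A vertex other than the root is given by the path of left/right turns leading to it
  from the child of the root (which is thus the empty path), and it also stands for the
  edge connecting it to its parent.
\<close>

type_synonym btree = "unit tree"

datatype dir = L | R

type_synonym vertex = "dir list"

fun internal :: "btree \<Rightarrow> vertex set" where
  "internal Leaf = {}"
| "internal (Node l _ r) = insert [] ((#) L ` internal l \<union> (#) R ` internal r)"

fun leaf_list :: "btree \<Rightarrow> vertex list" where
  "leaf_list Leaf = [[]]"
| "leaf_list (Node l _ r) = map ((#) L) (leaf_list l) @ map ((#) R) (leaf_list r)"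

definition edges :: "btree \<Rightarrow> vertex set" where
  "edges t = internal t \<union> set (leaf_list t)"

lemma card_internal: "finite (internal t) \<and> card (internal t) = size t"
proof (induction t)
  case (Node l x r)
  have "card ((#) L ` internal l \<union> (#) R ` internal r) = size l + size r"
    using Node by (subst card_Un_disjoint) (auto simp: card_image)
  with Node show ?case by (subst internal.simps, subst card_insert_disjoint) auto
qed simp

lemma length_leaf_list: "length (leaf_list t) = size t + 1"
  by (induction t) auto

type_synonym color = "bit \<times> bit"

abbreviation color1 :: color where "color1 \<equiv> (0, 1)"
abbreviation color2 :: color where "color2 \<equiv> (1, 0)"
abbreviation color3 :: color where "color3 \<equiv> (1, 1)"

definition is_coloring :: "btree \<Rightarrow> color list \<Rightarrow> (vertex \<Rightarrow> color) \<Rightarrow> bool" where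
  "is_coloring t c \<chi> \<longleftrightarrow>
     map \<chi> (leaf_list t) = c \<and> (\<forall>v\<in>internal t. \<chi> v + \<chi> (v @ [L]) + \<chi> (v @ [R]) = 0)"

lemma is_coloring_unique:
  assumes "is_coloring t c \<chi>" "is_coloring t c \<chi>'" "e \<in> edges t"
  shows "\<chi> e = \<chi>' e"
  using assms
proof (induction t arbitrary: c \<chi> \<chi>' e)
  case Leaf
  then show ?case by (auto simp: is_coloring_def edges_def)
next
  case (Node l x r)
  let ?n = "length (leaf_list l)"
  have l: "is_coloring l (take ?n c) (\<lambda>v. \<eta> (L # v))"
    and r: "is_coloring r (drop ?n c) (\<lambda>v. \<eta> (R # v))"
    if "is_coloring (Node l x r) c \<eta>" for \<eta>
    using that by (auto simp: is_coloring_def o_def ball_Un)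
  have L: "\<chi> (L # v) = \<chi>' (L # v)" if "v \<in> edges l" for v
    using Node.IH(1)[OF l[OF Node.prems(1)] l[OF Node.prems(2)] that] .
  have R: "\<chi> (R # v) = \<chi>' (R # v)" if "v \<in> edges r" for v
    using Node.IH(2)[OF r[OF Node.prems(1)] r[OF Node.prems(2)] that] .
  have nil: "[] \<in> edges t" for t
    by (cases t) (auto simp: edges_def)
  have "\<chi> [] + (\<chi> [L] + \<chi> [R]) = 0" "\<chi>' [] + (\<chi>' [L] + \<chi>' [R]) = 0"
    using Node.prems by (auto simp: is_coloring_def add.assoc)
  then have "\<chi> [] = \<chi>' []"
    using L[OF nil] R[OF nil] by (metis add_right_cancel)
  with L R Node.prems(3) show ?case
    by (auto simp: edges_def)
qed

lemma is_coloring_exists: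
  assumes "length c = size t + 1"
  shows "\<exists>\<chi>. is_coloring t c \<chi>"
  using assms
proof (induction t arbitrary: c)
  case Leaf
  then show ?case
    by (intro exI[of _ "\<lambda>_. hd c"]) (cases c; auto simp: is_coloring_def)
next
  case (Node l x r)
  let ?n = "size l + 1"
  obtain f where f: "is_coloring l (take ?n c) f"
    using Node.IH(1)[of "take ?n c"] Node.prems by auto
  obtain g where g: "is_coloring r (drop ?n c) g"
    using Node.IH(2)[of "drop ?n c"] Node.prems by auto
  define \<chi> where "\<chi> v = (case v of [] \<Rightarrow> - (f [] + g []) | L # w \<Rightarrow> f w | R # w \<Rightarrow> g w)" for v
  have [simp]: "\<chi> [] = - (f [] + g [])" "\<And>w. \<chi> (L # w) = f w" "\<And>w. \<chi> (R # w) = g w"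
    by (simp_all add: \<chi>_def)
  have "map \<chi> (leaf_list (Node l x r)) = take ?n c @ drop ?n c"
    using f g by (simp add: is_coloring_def o_def del: append_take_drop_id)
  moreover have "- (f [] + g []) + f [] + g [] = 0"
    by (metis add.assoc left_minus)
  ultimately show ?case
    using f g by (intro exI[of _ \<chi>]) (auto simp: is_coloring_def)
qed

text \<open>
  Two edges share a vertex only at an internal vertex, so properness is a
  condition on the three edges at each internal vertex.
\<close>

definition proper_coloring :: "btree \<Rightarrow> (vertex \<Rightarrow> color) \<Rightarrow> bool" where
  "proper_coloring t \<chi> \<longleftrightarrow>
     (\<forall>v\<in>internal t. distinct [\<chi> v, \<chi> (v @ [L]), \<chi> (v @ [R])])"

text \<open>
  The coloring \<open>\<chi>\<close> is determined by \<open>t\<close> and \<open>c\<close> only on \<open>edges t\<close>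
  (see lemma \<open>is_coloring_unique\<close>); nothing below depends on its other values.
\<close>

definition valid_coloring :: "btree \<Rightarrow> color list \<Rightarrow> (vertex \<Rightarrow> color) \<Rightarrow> bool" where
  "valid_coloring t c \<chi> \<longleftrightarrow>
     is_coloring t c \<chi> \<and> proper_coloring t \<chi> \<and> \<chi> ` edges t \<subseteq> {color1, color2, color3}"

definition valid :: "btree \<Rightarrow> color list \<Rightarrow> bool" where
  "valid t c \<longleftrightarrow> (\<exists>\<chi>. valid_coloring t c \<chi>)"

definition acceptable :: "color list \<Rightarrow> bool" where
  "acceptable c \<longleftrightarrow> (\<exists>t. valid t c)"

datatype sign = Plus | Minus

definition derived_sign :: "(vertex \<Rightarrow> color) \<Rightarrow> vertex \<Rightarrow> sign" where
  "derived_sign \<chi> v =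
     (if (\<chi> v, \<chi> (v @ [L]), \<chi> (v @ [R])) \<in>
           {(color1, color2, color3), (color2, color3, color1), (color3, color1, color2)}
      then Plus else Minus)"

definition adjacent :: "vertex \<Rightarrow> vertex \<Rightarrow> bool" where
  "adjacent u v \<longleftrightarrow> (\<exists>d. v = u @ [d] \<or> u = v @ [d])"

definition rigid :: "btree \<Rightarrow> (vertex \<Rightarrow> sign) \<Rightarrow> bool" where
  "rigid t \<sigma> \<longleftrightarrow> (\<forall>u\<in>internal t. \<forall>v\<in>internal t. adjacent u v \<longrightarrow> \<sigma> u \<noteq> \<sigma> v)"

definition positive_rigid :: "btree \<Rightarrow> (vertex \<Rightarrow> sign) \<Rightarrow> bool" where
  "positive_rigid t \<sigma> \<longleftrightarrow> rigid t \<sigma> \<and> [] \<in> internal t \<and> \<sigma> [] = Plus"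

definition flexible :: "btree \<Rightarrow> (vertex \<Rightarrow> sign) \<Rightarrow> bool" where
  "flexible t \<sigma> \<longleftrightarrow> \<not> rigid t \<sigma>"

definition flexible_vector :: "color list \<Rightarrow> bool" where
  "flexible_vector c \<longleftrightarrow> (\<exists>t \<chi>. valid_coloring t c \<chi> \<and> flexible t (derived_sign \<chi>))"

definition positive_rigid_vector :: "color list \<Rightarrow> bool" where
  "positive_rigid_vector c \<longleftrightarrow>
     (\<exists>t \<chi>. valid_coloring t c \<chi> \<and> positive_rigid t (derived_sign \<chi>))"

definition orbit :: "color list \<Rightarrow> color list set" where
  "orbit c = {map \<pi> c | \<pi>. \<pi> permutes {color1, color2, color3}}"

definition num_flexible :: "nat \<Rightarrow> nat" where
  "num_flexible n = card (orbit ` {c. length c = n + 1 \<and> acceptable c \<and> flexible_vector c})"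

text \<open>
  Odd permutations of the colors reverse all signs, so the set of positive rigid vectors is not
  closed under the action; the orbits counted here are those that contain a positive rigid vector.
\<close>

definition num_positive_rigid :: "nat \<Rightarrow> nat" where
  "num_positive_rigid n =
     card (orbit ` {c. length c = n + 1 \<and> acceptable c \<and> positive_rigid_vector c})"

end

theory Submission
  imports Defs
begin

text \<open>
  A binary tree with \<open>n\<close> internal vertices is dual to a triangulation of a polygon with \<open>n + 2\<close>
  vertices: leaves and root edge become the sides, nodes become triangles.  Color the vertices of
  the polygon by the partial sums \<open>0\<close>, \<open>c\<^sub>1\<close>, \<open>c\<^sub>1 + c\<^sub>2\<close>, ... of a color vector \<open>c\<close>.  The edge coloring
  that \<open>c\<close> determines on a tree gives to each side or diagonal the sum of the colors of its two
  ends, so \<open>c\<close> is valid for the tree exactly if this vertex coloring is proper on the triangulation.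

  Everything that is counted depends only on how many vertex colors occur.  For \<open>n \<ge> 1\<close>, a proper
  coloring of the polygon is proper on some triangulation exactly if it uses at least three colors
  (\<open>acceptable_iff_card_visited\<close>).  Two triangles with a common edge have opposite signs exactly if
  the vertices opposite to this edge have equal colors; so all adjacent signs are opposite exactly
  if the colors of one triangle are the only ones, that is, if some color is missing
  (\<open>rigid_iff_visited_not_UNIV\<close>).  In particular rigidity does not depend on the tree.  Hence
  acceptable vectors are flexible if they use four vertex colors and rigid if they use three, and
  an odd permutation of the colors makes a rigid vector positive if it is not.

  It remains to count colorings.  Let \<open>N\<^sub>k(m)\<close> be the number of vectors of length \<open>m\<close> with nonzero
  entries, nonzero sum and \<open>k\<close> partial sums, and \<open>T\<^sub>k(m)\<close> the same number without the condition on
  the sum, which counts colorings of a path.  Adding a vertex to a path gives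
  \<open>T\<^sub>4(m + 1) = 3 T\<^sub>4(m) + T\<^sub>3(m)\<close>.  A path either closes up to a polygon or has ends of the same
  color, which can then be identified: \<open>T\<^sub>k(m + 1) = N\<^sub>k(m + 1) + N\<^sub>k(m)\<close>.  Therefore
  \<open>N\<^sub>4(m + 1) - 3 N\<^sub>4(m) - N\<^sub>3(m)\<close> changes its sign when \<open>m\<close> grows by one; since it vanishes for
  \<open>m = 0\<close>, it always vanishes.  Because \<open>S\<^sub>3\<close> acts freely on vectors with at least three partial
  sums, division by 6 gives the recurrence for the numbers of orbits.
\<close>

section \<open>The color group\<close>

lemma color_cases: "x \<in> {0, color1, color2, color3}" for x :: color
  by (cases x; cases "fst x"; cases "snd x") (auto simp: zero_prod_def)

lemma UNIV_color: "(UNIV :: color set) = {0, color1, color2, color3}"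
  using color_cases by auto

lemma card_color: "card (UNIV :: color set) = 4"
  by (simp add: UNIV_color zero_prod_def)

lemma finite_color [simp]: "finite (A :: color set)"
  by (rule finite_subset[OF subset_UNIV]) (simp add: UNIV_color)

lemma color_nonzero_iff: "x \<in> {color1, color2, color3} \<longleftrightarrow> x \<noteq> 0" for x :: color
  using color_cases[of x] by (auto simp: zero_prod_def)

lemma color_add_self [simp]: "x + x = 0" for x :: color
  using color_cases[of x] by (auto simp: zero_prod_def)

lemma color_add_eq_0_iff: "x + y = 0 \<longleftrightarrow> x = y" for x y :: color
  by (metis add_left_cancel color_add_self)

lemma color_third_eq_add:
  fixes x y z :: color
  assumes "x \<noteq> 0" "y \<noteq> 0" "z \<noteq> 0" "x \<noteq> y" "z \<noteq> x" "z \<noteq> y"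
  shows "z = x + y"
  using color_cases[of x] color_cases[of y] color_cases[of z] assms
  by (auto simp: zero_prod_def)


section \<open>Partial sums as vertex colors of the polygon\<close>

text \<open>
  The start \<open>a\<close> is a parameter because a subtree corresponds to a part of the polygon whose first
  vertex may have any color.
\<close>

fun visited :: "color \<Rightarrow> color list \<Rightarrow> color set" where
  "visited a [] = {a}"
| "visited a (x # c) = insert a (visited (a + x) c)"

lemma start_visited [simp]: "a \<in> visited a c"
  by (cases c) auto

lemma visited_append: "visited a (c @ d) = visited a c \<union> visited (a + sum_list c) d"
  by (induction c arbitrary: a) (auto simp: add.assoc)

lemma visited_not_empty [simp]: "visited a c \<noteq> {}"
  using start_visited[of a c] by blast

lemma end_visited [simp]: "a + sum_list c \<in> visited a c"
  by (induction c arbitrary: a) (auto simp: add.assoc[symmetric])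

lemma end_visited_0 [simp]: "sum_list c \<in> visited 0 c"
  using end_visited[of 0 c] by simp

lemma visited_snoc: "visited a (c @ [x]) = insert (a + sum_list c + x) (visited a c)"
  by (auto simp: visited_append)

lemma visited_prefix:
  assumes "b \<in> visited a c"
  obtains p q where "c = p @ q" "b = a + sum_list p"
  using assms
proof (induction c arbitrary: a thesis)
  case Nil
  then show ?case by (metis append_Nil visited.simps(1) singletonD sum_list.Nil add_0_right)
next
  case (Cons x c)
  show ?case
  proof (cases "b = a")
    case True
    then show ?thesis using Cons.prems(1)[of "[]" "x # c"] by simp
  next
    case False
    then have "b \<in> visited (a + x) c" using Cons.prems by simp
    then obtain p q where "c = p @ q" "b = (a + x) + sum_list p" using Cons.IH by blast
    then show ?thesis using Cons.prems(1)[of "x # p" q] by (simp add: add.assoc)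
  qed
qed


section \<open>Valid colorings and their signs, one node at a time\<close>

lemma Nil_in_edges [simp]: "[] \<in> edges t"
  by (cases t) (auto simp: edges_def)

lemma Nil_in_internal [simp]: "[] \<in> internal t \<longleftrightarrow> t \<noteq> Leaf"
  by (cases t) auto

lemma edges_Node: "edges (Node l u r) = insert [] ((#) L ` edges l \<union> (#) R ` edges r)"
  by (auto simp: edges_def)

lemma valid_coloring_iff:
  "valid_coloring t c \<chi> \<longleftrightarrow>
     is_coloring t c \<chi> \<and> proper_coloring t \<chi> \<and> (\<forall>e\<in>edges t. \<chi> e \<noteq> 0)"
  unfolding valid_coloring_def image_subset_iff color_nonzero_iff ..

lemma valid_coloring_nonzero: "valid_coloring t c \<chi> \<Longrightarrow> v \<in> edges t \<Longrightarrow> \<chi> v \<noteq> 0"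
  unfolding valid_coloring_iff by auto

lemma valid_coloring_Leaf: "valid_coloring Leaf c \<chi> \<longleftrightarrow> c = [\<chi> []] \<and> \<chi> [] \<noteq> 0"
  by (auto simp: valid_coloring_iff is_coloring_def proper_coloring_def edges_def)

text \<open>
  The three edges at a node sum to 0, so in the presence of nonzero child edges properness reduces
  to the two child edges having different colors; the parent edge is then nonzero and different
  from both.
\<close>

lemma valid_coloring_Node:
  "valid_coloring (Node l u r) c \<chi> \<longleftrightarrow>
     (\<exists>c1 c2. c = c1 @ c2 \<and> valid_coloring l c1 (\<lambda>v. \<chi> (L # v)) \<and>
        valid_coloring r c2 (\<lambda>v. \<chi> (R # v)) \<and>
        \<chi> [] = \<chi> [L] + \<chi> [R] \<and> \<chi> [L] \<noteq> \<chi> [R])" (is "?A \<longleftrightarrow> ?B")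
proof
  assume A: ?A
  let ?c1 = "map (\<lambda>v. \<chi> (L # v)) (leaf_list l)" and ?c2 = "map (\<lambda>v. \<chi> (R # v)) (leaf_list r)"
  have "c = ?c1 @ ?c2"
    using A by (auto simp: valid_coloring_iff is_coloring_def o_def)
  moreover have "valid_coloring l ?c1 (\<lambda>v. \<chi> (L # v))" "valid_coloring r ?c2 (\<lambda>v. \<chi> (R # v))"
    using A
    by (auto simp: valid_coloring_iff is_coloring_def proper_coloring_def edges_Node ball_Un)
  moreover have "\<chi> [] + (\<chi> [L] + \<chi> [R]) = 0" "\<chi> [L] \<noteq> \<chi> [R]"
    using A by (auto simp: valid_coloring_iff is_coloring_def proper_coloring_def add.assoc)
  ultimately show ?B
    unfolding color_add_eq_0_iff by blast
next
  assume ?B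
  then obtain c1 c2 where c: "c = c1 @ c2" and l: "valid_coloring l c1 (\<lambda>v. \<chi> (L # v))"
    and r: "valid_coloring r c2 (\<lambda>v. \<chi> (R # v))"
    and n: "\<chi> [] = \<chi> [L] + \<chi> [R]" "\<chi> [L] \<noteq> \<chi> [R]" by blast
  have nz: "\<chi> [L] \<noteq> 0" "\<chi> [R] \<noteq> 0"
    using valid_coloring_nonzero[OF l, of "[]"] valid_coloring_nonzero[OF r, of "[]"] by auto
  have "is_coloring (Node l u r) c \<chi>"
    using c l r n
    by (auto simp: valid_coloring_iff is_coloring_def o_def add.assoc)
  moreover have "proper_coloring (Node l u r) \<chi>"
    using l r n nz by (auto simp: valid_coloring_iff proper_coloring_def)
  moreover have "\<chi> [] \<noteq> 0"
    unfolding n using n(2) by (simp add: color_add_eq_0_iff)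
  then have "\<forall>e\<in>edges (Node l u r). \<chi> e \<noteq> 0"
    using l r by (auto simp: valid_coloring_iff edges_Node)
  ultimately show ?A
    by (simp add: valid_coloring_iff)
qed

lemma valid_coloring_sum: "valid_coloring t c \<chi> \<Longrightarrow> sum_list c = \<chi> []"
proof (induction t arbitrary: c \<chi>)
  case (Node l u r)
  from Node.prems obtain c1 c2 where "c = c1 @ c2" "valid_coloring l c1 (\<lambda>v. \<chi> (L # v))"
    "valid_coloring r c2 (\<lambda>v. \<chi> (R # v))" "\<chi> [] = \<chi> [L] + \<chi> [R]"
    unfolding valid_coloring_Node by blast
  with Node.IH show ?case by simp
qed (simp add: valid_coloring_Leaf)

lemma valid_coloring_leaves_nonzero: "valid_coloring t c \<chi> \<Longrightarrow> 0 \<notin> set c"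
proof (induction t arbitrary: c \<chi>)
  case (Node l u r)
  from Node.prems obtain c1 c2 where "c = c1 @ c2" "valid_coloring l c1 (\<lambda>v. \<chi> (L # v))"
    "valid_coloring r c2 (\<lambda>v. \<chi> (R # v))"
    unfolding valid_coloring_Node by blast
  with Node.IH show ?case by auto
qed (simp add: valid_coloring_Leaf)

lemma valid_coloring_length: "valid_coloring t c \<chi> \<Longrightarrow> length c = size t + 1"
  by (auto simp: valid_coloring_def is_coloring_def length_leaf_list)

lemma rigid_Leaf [simp]: "rigid Leaf \<sigma>"
  by (simp add: rigid_def)

lemma rigid_Node:
  "rigid (Node l u r) \<sigma> \<longleftrightarrow> rigid l (\<lambda>v. \<sigma> (L # v)) \<and> rigid r (\<lambda>v. \<sigma> (R # v)) \<and>
     (l \<noteq> Leaf \<longrightarrow> \<sigma> [L] \<noteq> \<sigma> []) \<and> (r \<noteq> Leaf \<longrightarrow> \<sigma> [R] \<noteq> \<sigma> [])" (is "?A \<longleftrightarrow> ?B")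
proof
  assume ?A
  then show ?B by (auto simp: rigid_def adjacent_def)
next
  assume ?B
  then show ?A
    by (auto simp: rigid_def adjacent_def ball_Un Cons_eq_append_conv append_eq_Cons_conv)
qed

lemma derived_sign_Cons: "derived_sign \<chi> (d # v) = derived_sign (\<lambda>v. \<chi> (d # v)) v"
  by (simp add: derived_sign_def)

section \<open>Rigid means three vertex colors\<close>

lemma valid_coloring_child_colors:
  assumes "valid_coloring (Node l u r) c \<chi>"
  shows "\<chi> [] = \<chi> [L] + \<chi> [R]" "\<chi> [L] \<noteq> \<chi> [R]" "\<chi> [L] \<noteq> 0" "\<chi> [R] \<noteq> 0" "\<chi> [] \<noteq> 0"
  using assms valid_coloring_nonzero[OF assms, of "[L]"] valid_coloring_nonzero[OF assms, of "[R]"]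
    valid_coloring_nonzero[OF assms, of "[]"]
  by (auto simp: valid_coloring_Node edges_Node)

text \<open>
  The triangles dual to two adjacent nodes share an edge, and their signs are opposite exactly if
  the two vertices opposite to that edge have the same color.  Measured from the first vertex of
  the polygon, these two colors are \<open>\<chi> [L, L]\<close> and \<open>\<chi> []\<close> for a left child; for a right child they
  are \<open>\<chi> [L] + \<chi> [R, L]\<close> and \<open>0\<close>.
\<close>

lemma left_child_sign_opposite_iff:
  assumes "valid_coloring (Node l u r) c \<chi>" "l \<noteq> Leaf"
  shows "derived_sign \<chi> [L] \<noteq> derived_sign \<chi> [] \<longleftrightarrow> \<chi> [L, L] = \<chi> []"
proof -
  obtain c1 where "valid_coloring l c1 (\<lambda>v. \<chi> (L # v))"
    using assms(1) unfolding valid_coloring_Node by blast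
  moreover obtain t1 v t2 where "l = Node t1 v t2"
    using assms(2) by (cases l) auto
  ultimately have child: "valid_coloring (Node t1 v t2) c1 (\<lambda>v. \<chi> (L # v))" by simp
  note colors = valid_coloring_child_colors[OF assms(1)] valid_coloring_child_colors[OF child]
  have "derived_sign \<chi> [L] \<noteq> derived_sign \<chi> [] \<longleftrightarrow> x = x + y + z"
    if "\<chi> [L, L] = x" "\<chi> [L, R] = y" "\<chi> [R] = z" for x y z
    using colors color_cases[of x] color_cases[of y] color_cases[of z]
    unfolding derived_sign_def that
    by (elim insertE emptyE) (simp_all add: that zero_prod_def)
  from this[OF refl refl refl] show ?thesis
    using colors by simp
qed

lemma right_child_sign_opposite_iff:
  assumes "valid_coloring (Node l u r) c \<chi>" "r \<noteq> Leaf"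
  shows "derived_sign \<chi> [R] \<noteq> derived_sign \<chi> [] \<longleftrightarrow> \<chi> [R, L] = \<chi> [L]"
proof -
  obtain c2 where "valid_coloring r c2 (\<lambda>v. \<chi> (R # v))"
    using assms(1) unfolding valid_coloring_Node by blast
  moreover obtain t1 v t2 where "r = Node t1 v t2"
    using assms(2) by (cases r) auto
  ultimately have child: "valid_coloring (Node t1 v t2) c2 (\<lambda>v. \<chi> (R # v))" by simp
  note colors = valid_coloring_child_colors[OF assms(1)] valid_coloring_child_colors[OF child]
  have "derived_sign \<chi> [R] \<noteq> derived_sign \<chi> [] \<longleftrightarrow> y = x"
    if "\<chi> [L] = x" "\<chi> [R, L] = y" "\<chi> [R, R] = z" for x y z
    using colors color_cases[of x] color_cases[of y] color_cases[of z]
    unfolding derived_sign_def that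
    by (elim insertE emptyE) (simp_all add: that zero_prod_def)
  from this[OF refl refl refl] show ?thesis
    using colors by simp
qed

text \<open>
  The triangle at the root has its third vertex between the part of the polygon that belongs to
  the left subtree and the part that belongs to the right one.
\<close>

lemma apex_visited:
  assumes "valid_coloring (Node l u r) c \<chi>"
  shows "a + \<chi> [L] \<in> visited a c"
proof -
  obtain c1 c2 where "c = c1 @ c2" "valid_coloring l c1 (\<lambda>v. \<chi> (L # v))"
    using assms unfolding valid_coloring_Node by blast
  then show ?thesis
    using valid_coloring_sum end_visited[of a c1] by (auto simp: visited_append)
qed

text \<open>
  In a rigid coloring each triangle repeats the colors of its neighbor, so the colors of the root
  triangle are all that occur.  For a leaf the polygon is the single edge from \<open>a\<close> to \<open>a + \<chi> []\<close>,
  and \<open>\<chi> [L]\<close> is an arbitrary value.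
\<close>

lemma rigid_imp_visited_subset:
  assumes "valid_coloring t c \<chi>" "rigid t (derived_sign \<chi>)"
  shows "visited a c \<subseteq> {a, a + \<chi> [], a + \<chi> [L]}"
  using assms
proof (induction t arbitrary: c \<chi> a)
  case (Node l u r)
  obtain c1 c2 where c: "c = c1 @ c2" and l: "valid_coloring l c1 (\<lambda>v. \<chi> (L # v))"
    and r: "valid_coloring r c2 (\<lambda>v. \<chi> (R # v))"
    using Node.prems(1) unfolding valid_coloring_Node by blast
  have rigid: "rigid l (derived_sign (\<lambda>v. \<chi> (L # v)))" "rigid r (derived_sign (\<lambda>v. \<chi> (R # v)))"
    "l \<noteq> Leaf \<Longrightarrow> derived_sign \<chi> [L] \<noteq> derived_sign \<chi> []"
    "r \<noteq> Leaf \<Longrightarrow> derived_sign \<chi> [R] \<noteq> derived_sign \<chi> []"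
    using Node.prems(2) by (simp_all add: rigid_Node derived_sign_Cons[abs_def])
  have "visited a c1 \<subseteq> {a, a + \<chi> [], a + \<chi> [L]}"
  proof (cases "l = Leaf")
    case True
    with l show ?thesis by (auto simp: valid_coloring_Leaf)
  next
    case False
    then have "\<chi> [L, L] = \<chi> []"
      using left_child_sign_opposite_iff[OF Node.prems(1)] rigid(3) by blast
    with Node.IH(1)[OF l rigid(1), of a] show ?thesis by auto
  qed
  moreover have "visited (a + \<chi> [L]) c2 \<subseteq> {a, a + \<chi> [], a + \<chi> [L]}"
  proof (cases "r = Leaf")
    case True
    with r show ?thesis
      using valid_coloring_child_colors(1)[OF Node.prems(1)]
      by (auto simp: valid_coloring_Leaf add.assoc)
  next
    case False
    then have "\<chi> [R, L] = \<chi> [L]"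
      using right_child_sign_opposite_iff[OF Node.prems(1)] rigid(4) by blast
    with Node.IH(2)[OF r rigid(2), of "a + \<chi> [L]"] show ?thesis
      using valid_coloring_child_colors(1)[OF Node.prems(1)] by (auto simp: add.assoc)
  qed
  ultimately show ?case
    using valid_coloring_sum[OF l] by (auto simp: c visited_append)
qed (auto simp: valid_coloring_Leaf)

lemma four_distinct_colors_eq_UNIV:
  fixes w x y z :: color
  assumes "distinct [w, x, y, z]"
  shows "{w, x, y, z} = UNIV"
  by (rule card_subset_eq) (use assms in \<open>simp_all add: card_color\<close>)

text \<open>
  If two adjacent triangles had equal signs, their four vertices would carry all four colors.
\<close>

lemma visited_not_UNIV_imp_rigid:
  assumes "valid_coloring t c \<chi>" "visited a c \<noteq> UNIV"
  shows "rigid t (derived_sign \<chi>)"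
  using assms
proof (induction t arbitrary: c \<chi> a)
  case (Node l u r)
  obtain c1 c2 where c: "c = c1 @ c2" and l: "valid_coloring l c1 (\<lambda>v. \<chi> (L # v))"
    and r: "valid_coloring r c2 (\<lambda>v. \<chi> (R # v))"
    using Node.prems(1) unfolding valid_coloring_Node by blast
  note root = valid_coloring_child_colors[OF Node.prems(1)]
  have V: "visited a c = visited a c1 \<union> visited (a + \<chi> [L]) c2"
    using valid_coloring_sum[OF l] by (simp add: c visited_append)
  have three: "{a, a + \<chi> [], a + \<chi> [L]} \<subseteq> visited a c"
    using apex_visited[OF Node.prems(1)] end_visited[of a c] valid_coloring_sum[OF Node.prems(1)]
    by simp
  have "\<chi> [L, L] = \<chi> []" if nonleaf: "l \<noteq> Leaf"
  proof (rule ccontr)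
    assume ne: "\<chi> [L, L] \<noteq> \<chi> []"
    obtain l1 u1 r1 where l': "valid_coloring (Node l1 u1 r1) c1 (\<lambda>v. \<chi> (L # v))"
      using nonleaf l by (cases l) auto
    have "{a, a + \<chi> [], a + \<chi> [L], a + \<chi> [L, L]} = UNIV"
      using ne root valid_coloring_child_colors[OF l']
      by (intro four_distinct_colors_eq_UNIV) auto
    moreover have "{a, a + \<chi> [], a + \<chi> [L], a + \<chi> [L, L]} \<subseteq> visited a c"
      using three apex_visited[OF l', of a] V by simp
    ultimately show False using Node.prems(2) by (simp add: top.extremum_unique)
  qed
  moreover have "\<chi> [R, L] = \<chi> [L]" if nonleaf: "r \<noteq> Leaf"
  proof (rule ccontr)
    assume ne: "\<chi> [R, L] \<noteq> \<chi> [L]"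
    obtain l1 u1 r1 where r': "valid_coloring (Node l1 u1 r1) c2 (\<lambda>v. \<chi> (R # v))"
      using nonleaf r by (cases r) auto
    have "{a, a + \<chi> [], a + \<chi> [L], a + \<chi> [L] + \<chi> [R, L]} = UNIV"
      using ne root valid_coloring_child_colors[OF r']
      by (intro four_distinct_colors_eq_UNIV) (auto simp: add.assoc color_add_eq_0_iff)
    moreover have "{a, a + \<chi> [], a + \<chi> [L], a + \<chi> [L] + \<chi> [R, L]} \<subseteq> visited a c"
      using three apex_visited[OF r', of "a + \<chi> [L]"] V by simp
    ultimately show False using Node.prems(2) by (simp add: top.extremum_unique)
  qed
  moreover have "rigid l (derived_sign (\<lambda>v. \<chi> (L # v)))" "rigid r (derived_sign (\<lambda>v. \<chi> (R # v)))"
    using Node.IH(1)[OF l, of a] Node.IH(2)[OF r, of "a + \<chi> [L]"] V Node.prems(2) by auto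
  ultimately show ?case
    using left_child_sign_opposite_iff[OF Node.prems(1)]
      right_child_sign_opposite_iff[OF Node.prems(1)]
    by (simp add: rigid_Node derived_sign_Cons[abs_def])
qed simp

lemma rigid_iff_visited_not_UNIV:
  assumes "valid_coloring t c \<chi>"
  shows "rigid t (derived_sign \<chi>) \<longleftrightarrow> visited a c \<noteq> UNIV"
proof
  assume "rigid t (derived_sign \<chi>)"
  from card_mono[OF _ rigid_imp_visited_subset[OF assms this, of a]]
  have "card (visited a c) \<le> card {a, a + \<chi> [], a + \<chi> [L]}" by simp
  also have "\<dots> \<le> 3" by (simp add: card_insert_if)
  finally show "visited a c \<noteq> UNIV" using card_color by auto
qed (rule visited_not_UNIV_imp_rigid[OF assms])


section \<open>Acceptable vectors\<close>

lemma valid_Leaf: "x \<noteq> 0 \<Longrightarrow> valid Leaf [x]"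
  unfolding valid_def by (rule exI[of _ "\<lambda>_. x"]) (simp add: valid_coloring_Leaf)

lemma valid_Node:
  assumes "valid l c1" "valid r c2" "sum_list c1 \<noteq> sum_list c2"
  shows "valid (Node l u r) (c1 @ c2)"
proof -
  obtain f g where f: "valid_coloring l c1 f" and g: "valid_coloring r c2 g"
    using assms(1,2) by (auto simp: valid_def)
  define \<chi> where "\<chi> v = (case v of [] \<Rightarrow> f [] + g [] | L # w \<Rightarrow> f w | R # w \<Rightarrow> g w)" for v
  have [simp]: "\<chi> [] = f [] + g []" "\<And>w. \<chi> (L # w) = f w" "\<And>w. \<chi> (R # w) = g w"
    by (simp_all add: \<chi>_def)
  have "f [] \<noteq> g []"
    using assms(3) valid_coloring_sum[OF f] valid_coloring_sum[OF g] by simp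
  with f g have "valid_coloring (Node l u r) (c1 @ c2) \<chi>"
    unfolding valid_coloring_Node by (intro exI[of _ c1] exI[of _ c2]) simp
  then show ?thesis by (auto simp: valid_def)
qed

lemma acceptable_singleton: "x \<noteq> 0 \<Longrightarrow> acceptable [x]"
  unfolding acceptable_def using valid_Leaf by blast

lemma acceptable_append:
  "acceptable c1 \<Longrightarrow> acceptable c2 \<Longrightarrow> sum_list c1 \<noteq> sum_list c2 \<Longrightarrow> acceptable (c1 @ c2)"
  unfolding acceptable_def using valid_Node by blast

lemma acceptable_visited:
  assumes "acceptable c"
  shows "0 \<notin> set c" "sum_list c \<noteq> 0" "length c \<noteq> 1 \<Longrightarrow> \<not> visited 0 c \<subseteq> {0, sum_list c}"
proof -
  obtain t \<chi> where t: "valid_coloring t c \<chi>"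
    using assms by (auto simp: acceptable_def valid_def)
  show "0 \<notin> set c" "sum_list c \<noteq> 0"
    using valid_coloring_leaves_nonzero[OF t] valid_coloring_nonzero[OF t, of "[]"]
      valid_coloring_sum[OF t] by auto
  assume "length c \<noteq> 1"
  then obtain l u r where t': "valid_coloring (Node l u r) c \<chi>"
    using valid_coloring_length[OF t] t by (cases t) auto
  from apex_visited[OF this, of 0] valid_coloring_child_colors[OF this] valid_coloring_sum[OF this]
  show "\<not> visited 0 c \<subseteq> {0, sum_list c}" by auto
qed

text \<open>
  A properly colored polygon with at least three colors can be triangulated properly: choose as
  apex over the root edge the first vertex whose color differs from those of both ends of that
  edge.  The part to the left of the apex is then an edge or has three colors.  If the part to the
  right is neither, its colors alternate, and the last vertex before the end, which has the color
  of the apex, can serve as apex instead.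
\<close>

lemma acceptableI:
  assumes "0 \<notin> set c" "sum_list c \<noteq> 0" "length c \<noteq> 1 \<Longrightarrow> \<not> visited 0 c \<subseteq> {0, sum_list c}"
  shows "acceptable c"
  using assms
proof (induction "length c" arbitrary: c rule: less_induct)
  case less
  show ?case
  proof (cases "length c = 1")
    case True
    then obtain x where "c = [x]" by (cases c) auto
    with less.prems(1) show ?thesis by (auto intro: acceptable_singleton)
  next
    case False
    \<comment> \<open>\<open>bend p\<close>: the prefix \<open>p\<close> leads to a vertex that can serve as apex over the root edge.\<close>
    define bend where "bend p \<longleftrightarrow> (\<exists>q. c = p @ q) \<and> sum_list p \<notin> {0, sum_list c}" for p
    have "\<exists>p. bend p"
      using less.prems(3)[OF False] visited_prefix[of _ 0 c] unfolding bend_def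
      by (metis add_0 subsetI)
    then obtain p where p: "bend p" and min: "\<And>p'. bend p' \<Longrightarrow> length p \<le> length p'"
      using ex_has_least_nat[of bend _ length] by blast
    obtain q where c: "c = p @ q"
      using p by (auto simp: bend_def)
    have s: "sum_list p \<noteq> 0" "sum_list p \<noteq> sum_list c" "sum_list q \<noteq> 0"
      "sum_list p \<noteq> sum_list q" "sum_list p + sum_list q \<noteq> 0"
      using p less.prems(2) by (auto simp: bend_def c color_add_eq_0_iff)
    then have ne: "p \<noteq> []" "q \<noteq> []" by auto
    have p3: "\<not> visited 0 p \<subseteq> {0, sum_list p}" if p1: "length p \<noteq> 1"
    proof -
      obtain x p' where p': "p = x # p'" "p' \<noteq> []"
        using ne(1) p1 by (cases p) auto
      then have "\<not> bend [x]" using min[of "[x]"] by auto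
      moreover have "x \<noteq> 0" using less.prems(1) by (auto simp: c p')
      ultimately have "x = sum_list c" by (auto simp: bend_def c p')
      then have "sum_list c \<in> visited 0 p" by (simp add: p')
      then show ?thesis using s(2) less.prems(2) by auto
    qed
    show ?thesis
    proof (cases "length q = 1 \<or> \<not> visited 0 q \<subseteq> {0, sum_list q}")
      case True
      have "acceptable p" "acceptable q"
        using less.hyps[of p] less.hyps[of q] p3 True s less.prems(1) ne by (auto simp: c)
      then show ?thesis
        unfolding c using s(4) by (rule acceptable_append)
    next
      case q2: False
      obtain q' z where q': "q = q' @ [z]" "q' \<noteq> []"
        using q2 ne(2) by (cases q rule: rev_cases) auto
      obtain y q'' where y: "q' = y # q''"
        using q'(2) by (cases q') auto
      have nz: "z \<noteq> 0" "y \<noteq> 0" using less.prems(1) by (auto simp: c q' y)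
      \<comment> \<open>The two colors of \<open>q\<close> alternate, so \<open>q'\<close> leads back to the color of the apex.\<close>
      have "sum_list q' \<in> visited 0 q" "y \<in> visited 0 q"
        by (auto simp: q' y visited_append intro: end_visited)
      then have "sum_list q' \<in> {0, sum_list q}" "y = sum_list q"
        using q2 nz by auto
      then have q'0: "sum_list q' = 0" and z: "z = sum_list q"
        using nz by (auto simp: q')
      have "sum_list p + y \<in> visited 0 (p @ q')"
        by (simp add: visited_append y)
      moreover have "sum_list p + y \<notin> {0, sum_list p}"
        using s(5) nz \<open>y = sum_list q\<close> by simp
      ultimately have "\<not> visited 0 (p @ q') \<subseteq> {0, sum_list (p @ q')}"
        using q'0 by auto
      then have pq': "acceptable (p @ q')"
        using less.prems(1) s(1) q'0 by (intro less.hyps) (auto simp: c q')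
      have "acceptable ((p @ q') @ [z])"
        using acceptable_append[OF pq' acceptable_singleton[OF nz(1)]] s(4) z q'0 by simp
      then show ?thesis by (simp add: c q')
    qed
  qed
qed

text \<open>
  The length 1 is excluded since the tree without nodes is valid for every vector \<open>[x]\<close> with
  \<open>x \<noteq> 0\<close>, which has only two partial sums.
\<close>

lemma acceptable_iff_card_visited:
  assumes "length c \<ge> 2"
  shows "acceptable c \<longleftrightarrow> 0 \<notin> set c \<and> sum_list c \<noteq> 0 \<and> 3 \<le> card (visited 0 c)"
proof -
  have "3 \<le> card (visited 0 c) \<longleftrightarrow> \<not> visited 0 c \<subseteq> {0, sum_list c}" if s: "sum_list c \<noteq> 0"
  proof
    assume "3 \<le> card (visited 0 c)"
    with s show "\<not> visited 0 c \<subseteq> {0, sum_list c}"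
      using card_mono[of "{0, sum_list c}" "visited 0 c"] by auto
  next
    assume "\<not> visited 0 c \<subseteq> {0, sum_list c}"
    then obtain x where "x \<in> visited 0 c" "x \<notin> {0, sum_list c}" by blast
    with s show "3 \<le> card (visited 0 c)"
      using card_mono[of "visited 0 c" "{x, 0, sum_list c}"] by auto
  qed
  then show ?thesis
    using acceptable_visited[of c] acceptableI[of c] assms by auto
qed


section \<open>The action of the symmetric group\<close>

context
  fixes \<pi> :: "color \<Rightarrow> color"
  assumes perm: "\<pi> permutes {color1, color2, color3}"
begin

lemma color_perm_inj [simp]: "\<pi> x = \<pi> y \<longleftrightarrow> x = y"
  using permutes_inj[OF perm] by (auto dest: injD)

lemma color_perm_0 [simp]: "\<pi> 0 = 0"
  using permutes_not_in[OF perm, of 0] by (simp add: zero_prod_def)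

lemma color_perm_eq_0_iff [simp]: "\<pi> x = 0 \<longleftrightarrow> x = 0"
  using color_perm_inj[of x 0] by (simp del: color_perm_inj)

text \<open>
  Permutations of the nonzero elements are automorphisms of the Klein four-group: the sum of two
  distinct nonzero elements is the third one.
\<close>

lemma color_perm_add: "\<pi> (x + y) = \<pi> x + \<pi> y"
proof -
  consider "x = 0" | "y = 0" | "x = y" | "x \<noteq> 0" "y \<noteq> 0" "x \<noteq> y" by blast
  then show ?thesis
    by cases (auto intro!: color_third_eq_add simp: color_add_eq_0_iff)
qed

lemma sum_list_map_color_perm: "sum_list (map \<pi> c) = \<pi> (sum_list c)"
  by (induction c) (simp_all add: color_perm_add)

lemma visited_map_color_perm: "visited (\<pi> a) (map \<pi> c) = \<pi> ` visited a c"
  by (induction c arbitrary: a) (simp_all add: color_perm_add[symmetric])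

lemma card_visited_map_color_perm: "card (visited 0 (map \<pi> c)) = card (visited 0 c)"
  using visited_map_color_perm[of 0 c] permutes_inj_on[OF perm] by (simp add: card_image)

lemma valid_coloring_color_perm:
  "valid_coloring t c \<chi> \<Longrightarrow> valid_coloring t (map \<pi> c) (\<lambda>v. \<pi> (\<chi> v))"
proof (induction t arbitrary: c \<chi>)
  case (Node l u r)
  obtain c1 c2 where "c = c1 @ c2" "valid_coloring l c1 (\<lambda>v. \<chi> (L # v))"
    "valid_coloring r c2 (\<lambda>v. \<chi> (R # v))" "\<chi> [] = \<chi> [L] + \<chi> [R]" "\<chi> [L] \<noteq> \<chi> [R]"
    using Node.prems unfolding valid_coloring_Node by blast
  with Node.IH show ?case
    unfolding valid_coloring_Node
    by (intro exI[of _ "map \<pi> c1"] exI[of _ "map \<pi> c2"]) (simp add: color_perm_add)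
qed (simp add: valid_coloring_Leaf)

lemma orbit_map_color_perm: "orbit (map \<pi> c) = orbit c"
proof
  show "orbit (map \<pi> c) \<subseteq> orbit c"
    using permutes_compose[OF perm] by (force simp: orbit_def)
  show "orbit c \<subseteq> orbit (map \<pi> c)"
  proof
    fix d assume "d \<in> orbit c"
    then obtain \<rho> where \<rho>: "\<rho> permutes {color1, color2, color3}" "d = map \<rho> c"
      unfolding orbit_def by blast
    have "d = map (\<rho> \<circ> inv \<pi>) (map \<pi> c)"
      by (simp add: \<rho>(2) permutes_inverses[OF perm])
    then show "d \<in> orbit (map \<pi> c)"
      unfolding orbit_def using permutes_compose[OF permutes_inv[OF perm] \<rho>(1)] by blast
  qed
qed

end

lemma mem_orbit_self [simp]: "c \<in> orbit c"
proof -
  have "c = map id c" by simp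
  then show ?thesis unfolding orbit_def using permutes_id by blast
qed

lemma orbit_eq_if_mem:
  assumes "d \<in> orbit c"
  shows "orbit d = orbit c"
proof -
  obtain \<pi> where "\<pi> permutes {color1, color2, color3}" "d = map \<pi> c"
    using assms unfolding orbit_def by blast
  then show ?thesis by (simp add: orbit_map_color_perm)
qed

text \<open>
  Three partial sums include two distinct nonzero ones, which generate the color group, and an
  automorphism is determined by its values on generators.
\<close>

lemma color_perm_eq_if_map_eq:
  assumes \<pi>: "\<pi> permutes {color1, color2, color3}" and \<rho>: "\<rho> permutes {color1, color2, color3}"
    and c: "3 \<le> card (visited 0 c)" and eq: "map \<pi> c = map \<rho> c"
  shows "\<pi> = \<rho>"
proof -
  have agree: "\<pi> x = \<rho> x" if x: "x \<in> visited 0 c" for x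
  proof -
    obtain p q where pq: "c = p @ q" "x = sum_list p"
      using visited_prefix[OF x] by auto
    then have "sum_list (map \<pi> p) = sum_list (map \<rho> p)"
      using eq by (simp del: map_eq_conv)
    then show ?thesis
      by (simp add: pq(2) sum_list_map_color_perm[OF \<pi>] sum_list_map_color_perm[OF \<rho>])
  qed
  have "2 \<le> card (visited 0 c - {0})" using c by simp
  then obtain T where "T \<subseteq> visited 0 c - {0}" "card T = 2"
    by (rule obtain_subset_with_card_n)
  then obtain x y where xy: "x \<in> visited 0 c" "y \<in> visited 0 c" "x \<noteq> 0" "y \<noteq> 0" "x \<noteq> y"
    unfolding card_2_iff by blast
  show ?thesis
  proof
    fix z
    have "{0, x, y, x + y} = UNIV"
      using xy by (intro four_distinct_colors_eq_UNIV) (auto simp: color_add_eq_0_iff)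
    then consider "z = 0" | "z = x" | "z = y" | "z = x + y" by auto
    then show "\<pi> z = \<rho> z"
      using agree[OF xy(1)] agree[OF xy(2)]
      by cases (simp_all add: color_perm_0[OF \<pi>] color_perm_0[OF \<rho>]
          color_perm_add[OF \<pi>] color_perm_add[OF \<rho>])
  qed
qed

lemma card_orbit:
  assumes "3 \<le> card (visited 0 c)"
  shows "card (orbit c) = 6"
proof -
  let ?S = "{\<pi>. \<pi> permutes {color1, color2, color3}}"
  have "inj_on (\<lambda>\<pi>. map \<pi> c) ?S"
    using color_perm_eq_if_map_eq[OF _ _ assms] by (auto intro!: inj_onI)
  moreover have "orbit c = (\<lambda>\<pi>. map \<pi> c) ` ?S"
    by (auto simp: orbit_def)
  moreover have "card ?S = 6"
    using card_permutations[of "{color1, color2, color3}" 3] by (simp add: fact_numeral)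
  ultimately show ?thesis by (simp add: card_image)
qed


section \<open>Counting colored paths and polygons\<close>

text \<open>
  Vectors of length \<open>m\<close> with nonzero entries are the proper colorings with first color 0 of a path
  with \<open>m + 1\<close> vertices.  If the sum is nonzero too, joining the ends gives a properly colored
  polygon.  In both definitions \<open>k\<close> is the number of vertex colors.
\<close>

definition path_colorings :: "nat \<Rightarrow> nat \<Rightarrow> color list set" where
  "path_colorings m k = {c. length c = m \<and> 0 \<notin> set c \<and> card (visited 0 c) = k}"

definition polygon_colorings :: "nat \<Rightarrow> nat \<Rightarrow> color list set" where
  "polygon_colorings m k = {c \<in> path_colorings m k. sum_list c \<noteq> 0}"

lemma finite_path_colorings [simp]: "finite (path_colorings m k)"
  by (rule finite_subset[OF _ finite_lists_length_eq[of UNIV m]]) (auto simp: path_colorings_def)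

lemma finite_polygon_colorings [simp]: "finite (polygon_colorings m k)"
  by (simp add: polygon_colorings_def)

lemma card_polygon_colorings_eq_orbits:
  assumes "3 \<le> k"
  shows "card (polygon_colorings m k) = 6 * card (orbit ` polygon_colorings m k)"
proof -
  let ?P = "polygon_colorings m k"
  have "d \<in> ?P" if c: "c \<in> ?P" and d: "d \<in> orbit c" for c d
  proof -
    obtain \<pi> where \<pi>: "\<pi> permutes {color1, color2, color3}" "d = map \<pi> c"
      using d unfolding orbit_def by blast
    show ?thesis
      using c color_perm_eq_0_iff[OF \<pi>(1)]
      by (auto simp: polygon_colorings_def path_colorings_def \<pi>(2) sum_list_map_color_perm[OF \<pi>(1)]
          card_visited_map_color_perm[OF \<pi>(1)] dest: sym[of 0])
  qed
  then have "\<Union> (orbit ` ?P) = ?P" by auto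
  moreover have "6 * card (orbit ` ?P) = card (\<Union> (orbit ` ?P))"
  proof (rule card_partition)
    show "finite (\<Union> (orbit ` ?P))" by (simp add: \<open>\<Union> (orbit ` ?P) = ?P\<close>)
    show "card X = 6" if "X \<in> orbit ` ?P" for X
      using that assms by (auto simp: polygon_colorings_def path_colorings_def intro: card_orbit)
    show "X \<inter> Y = {}" if "X \<in> orbit ` ?P" "Y \<in> orbit ` ?P" "X \<noteq> Y" for X Y
      using that orbit_eq_if_mem by blast
  qed simp
  ultimately show ?thesis by simp
qed

text \<open>
  A new last vertex either repeats one of the \<open>k\<close> earlier colors that differ from the color of its
  predecessor, or it is the first vertex of its color.
\<close>

lemma card_path_colorings_Suc:
  "card (path_colorings (Suc m) (Suc k)) =
     k * card (path_colorings m (Suc k)) + (4 - k) * card (path_colorings m k)"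
proof -
  let ?old = "\<lambda>c. {x. x \<noteq> 0 \<and> sum_list c + x \<in> visited 0 c}"
  let ?new = "\<lambda>c. {x. sum_list c + x \<notin> visited 0 c}"
  let ?A = "SIGMA c:path_colorings m (Suc k). ?old c"
  let ?B = "SIGMA c:path_colorings m k. ?new c"
  let ?snoc = "\<lambda>(c, x). c @ [x]"
  have "path_colorings (Suc m) (Suc k) = ?snoc ` (?A \<union> ?B)"
  proof (intro equalityI subsetI)
    fix d assume d: "d \<in> path_colorings (Suc m) (Suc k)"
    then obtain c x where "d = c @ [x]"
      by (cases d rule: rev_cases) (auto simp: path_colorings_def)
    with d have "(c, x) \<in> ?A \<union> ?B"
      by (auto simp: path_colorings_def visited_snoc card_insert_if split: if_splits)
    with \<open>d = c @ [x]\<close> show "d \<in> ?snoc ` (?A \<union> ?B)" by (intro image_eqI) auto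
  next
    fix d assume "d \<in> ?snoc ` (?A \<union> ?B)"
    then obtain y where "y \<in> ?A \<union> ?B" "d = ?snoc y" by blast
    then obtain c x where cx: "d = c @ [x]" "(c, x) \<in> ?A \<union> ?B" by (cases y) simp
    moreover have "x \<noteq> 0" using cx(2) by auto
    ultimately show "d \<in> path_colorings (Suc m) (Suc k)"
      by (auto simp: path_colorings_def visited_snoc card_insert_if)
  qed
  moreover have "inj_on ?snoc (?A \<union> ?B)" by (auto intro!: inj_onI)
  ultimately have "card (path_colorings (Suc m) (Suc k)) = card (?A \<union> ?B)"
    by (simp add: card_image)
  also have "\<dots> = card ?A + card ?B"
    by (intro card_Un_disjoint finite_SigmaI finite_path_colorings finite_color)
      (auto simp: path_colorings_def)
  also have "card (?old c) = k" if "c \<in> path_colorings m (Suc k)" for c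
  proof -
    have "bij_betw ((+) (sum_list c)) (?old c) (visited 0 c - {sum_list c})"
      by (rule bij_betw_byWitness[where f' = "\<lambda>y. y - sum_list c"]) auto
    from bij_betw_same_card[OF this] that show ?thesis
      by (simp add: path_colorings_def)
  qed
  then have "card ?A = k * card (path_colorings m (Suc k))" by (subst card_SigmaI) auto
  also have "card (?new c) = 4 - k" if "c \<in> path_colorings m k" for c
  proof -
    have "bij_betw ((+) (sum_list c)) (?new c) (- visited 0 c)"
      by (rule bij_betw_byWitness[where f' = "\<lambda>y. y - sum_list c"]) auto
    from bij_betw_same_card[OF this] that show ?thesis
      by (simp add: path_colorings_def Compl_eq_Diff_UNIV card_Diff_subset
          card_color)
  qed
  then have "card ?B = (4 - k) * card (path_colorings m k)" by (subst card_SigmaI) auto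
  finally show ?thesis .
qed

text \<open>
  If the ends of a path have the same color, dropping the last vertex leaves a path whose ends
  differ and which has the same colors.
\<close>

lemma card_path_colorings_closing:
  "card (path_colorings (Suc m) k) =
     card (polygon_colorings (Suc m) k) + card (polygon_colorings m k)"
proof -
  let ?Z = "{c \<in> path_colorings (Suc m) k. sum_list c = 0}"
  have "bij_betw (\<lambda>c. c @ [sum_list c]) (polygon_colorings m k) ?Z"
  proof (rule bij_betw_imageI)
    show "inj_on (\<lambda>c. c @ [sum_list c]) (polygon_colorings m k)"
      by (auto intro!: inj_onI)
    show "(\<lambda>c. c @ [sum_list c]) ` polygon_colorings m k = ?Z"
    proof (intro equalityI subsetI)
      fix d assume "d \<in> (\<lambda>c. c @ [sum_list c]) ` polygon_colorings m k"
      then show "d \<in> ?Z"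
        by (auto simp: polygon_colorings_def path_colorings_def visited_snoc insert_absorb)
    next
      fix d assume d: "d \<in> ?Z"
      then obtain c x where cx: "d = c @ [x]"
        by (cases d rule: rev_cases) (auto simp: path_colorings_def)
      with d have "x = sum_list c" by (auto simp: color_add_eq_0_iff)
      with d cx show "d \<in> (\<lambda>c. c @ [sum_list c]) ` polygon_colorings m k"
        by (auto simp: polygon_colorings_def path_colorings_def visited_snoc insert_absorb
            intro!: image_eqI[of _ _ c])
    qed
  qed
  then have "card (polygon_colorings m k) = card ?Z" by (rule bij_betw_same_card)
  moreover have "path_colorings (Suc m) k = polygon_colorings (Suc m) k \<union> ?Z"
    by (auto simp: polygon_colorings_def)
  moreover have "card (polygon_colorings (Suc m) k \<union> ?Z) = card (polygon_colorings (Suc m) k) + card ?Z"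
    by (rule card_Un_disjoint) (auto simp: polygon_colorings_def)
  ultimately show ?thesis by simp
qed

lemma polygon_colorings_0 [simp]: "polygon_colorings 0 k = {}"
  by (auto simp: polygon_colorings_def path_colorings_def)

lemma path_colorings_0: "path_colorings 0 k = (if k = 1 then {[]} else {})"
  by (auto simp: path_colorings_def)

lemma card_path_colorings_1: "card (path_colorings (Suc 0) k) = (if k = 2 then 3 else 0)"
proof (cases k)
  case 0
  have "path_colorings (Suc 0) 0 = {}" by (auto simp: path_colorings_def)
  with 0 show ?thesis by simp
next
  case (Suc k')
  then show ?thesis by (simp add: card_path_colorings_Suc path_colorings_0)
qed

lemma card_polygon_colorings_1: "card (polygon_colorings (Suc 0) k) = (if k = 2 then 3 else 0)"
  using card_path_colorings_closing[of 0 k] by (simp add: card_path_colorings_1)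

lemma card_polygon_colorings_2: "card (polygon_colorings 2 3) = 6"
  using card_path_colorings_closing[of 1 3] card_path_colorings_Suc[of 1 2]
  by (simp add: numeral_eq_Suc card_path_colorings_1 card_polygon_colorings_1)

text \<open>
  The recurrence for paths, expressed by polygons, is the sum of this recurrence for \<open>m\<close> and for
  \<open>m + 1\<close>; hence each of them follows from the other.
\<close>

lemma card_polygon_colorings_rec:
  "card (polygon_colorings (Suc m) 4) = 3 * card (polygon_colorings m 4) + card (polygon_colorings m 3)"
proof (induction m)
  case 0
  then show ?case by (simp add: card_polygon_colorings_1)
next
  case (Suc m)
  have "card (path_colorings (Suc (Suc m)) 4) =
      3 * card (path_colorings (Suc m) 4) + card (path_colorings (Suc m) 3)"
    using card_path_colorings_Suc[of "Suc m" 3] by (simp add: eval_nat_numeral)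
  with Suc show ?case by (simp add: card_path_colorings_closing)
qed


section \<open>Flexible and rigid vectors are the polygon colorings\<close>

lemma visited_eq_UNIV_iff: "visited a c = UNIV \<longleftrightarrow> card (visited a c) = 4"
  using card_subset_eq[of UNIV "visited a c"] card_color by auto

lemma card_visited_le: "card (visited a c) \<le> 4"
  using card_mono[of UNIV "visited a c"] card_color by simp

lemma flexible_vectors_eq:
  assumes "n \<ge> 1"
  shows "{c. length c = n + 1 \<and> acceptable c \<and> flexible_vector c} = polygon_colorings (n + 1) 4"
proof -
  have "flexible_vector c \<longleftrightarrow> card (visited 0 c) = 4" if "acceptable c" for c
    using that rigid_iff_visited_not_UNIV[of _ c _ 0]
    unfolding flexible_vector_def flexible_def acceptable_def valid_def visited_eq_UNIV_iff
    by blast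
  then show ?thesis
    using assms by (auto simp: polygon_colorings_def path_colorings_def acceptable_iff_card_visited)
qed

lemma derived_sign_swap_colors:
  assumes "valid_coloring (Node l u r) c \<chi>"
  shows "derived_sign (\<lambda>v. transpose color1 color2 (\<chi> v)) [] \<noteq> derived_sign \<chi> []"
proof -
  have ?thesis if "\<chi> [L] = x" "\<chi> [R] = y" for x y
    using valid_coloring_child_colors[OF assms] color_cases[of x] color_cases[of y]
    unfolding derived_sign_def that
    by (elim insertE emptyE) (simp_all add: that zero_prod_def transpose_def)
  then show ?thesis by blast
qed

text \<open>
  Only the orbits agree: swapping two colors makes the root positive without changing rigidity, so
  every rigid vector shares its orbit with a positive one.
\<close>

lemma orbits_positive_rigid_eq:
  assumes "n \<ge> 1"
  shows "orbit ` {c. length c = n + 1 \<and> acceptable c \<and> positive_rigid_vector c} =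
    orbit ` polygon_colorings (n + 1) 3" (is "orbit ` ?P = orbit ` ?Q")
proof (intro equalityI subsetI)
  have "c \<in> ?Q" if c: "c \<in> ?P" for c
  proof -
    obtain t \<chi> where "valid_coloring t c \<chi>" "rigid t (derived_sign \<chi>)"
      using c by (auto simp: positive_rigid_vector_def positive_rigid_def)
    then have "card (visited 0 c) \<noteq> 4"
      using rigid_iff_visited_not_UNIV visited_eq_UNIV_iff by blast
    with c assms card_visited_le[of 0 c] show ?thesis
      by (auto simp: polygon_colorings_def path_colorings_def acceptable_iff_card_visited)
  qed
  then show "X \<in> orbit ` ?P \<Longrightarrow> X \<in> orbit ` ?Q" for X by blast
next
  fix X assume "X \<in> orbit ` ?Q"
  then obtain c where c: "c \<in> ?Q" and X: "X = orbit c" by blast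
  then have acc: "acceptable c" and len: "length c = n + 1"
    using assms by (auto simp: polygon_colorings_def path_colorings_def acceptable_iff_card_visited)
  obtain t \<chi> where t: "valid_coloring t c \<chi>"
    using acc by (auto simp: acceptable_def valid_def)
  obtain l u r where node: "t = Node l u r"
    using valid_coloring_length[OF t] len assms by (cases t) auto
  have positive: "d \<in> ?P"
    if d: "valid_coloring t d \<eta>" "derived_sign \<eta> [] = Plus" "card (visited 0 d) = 3" for d \<eta>
  proof -
    have "rigid t (derived_sign \<eta>)"
      using rigid_iff_visited_not_UNIV[OF d(1), of 0] d(3) by (simp add: visited_eq_UNIV_iff)
    then show ?thesis
      using d valid_coloring_length[OF d(1)] valid_coloring_length[OF t] len
      by (auto simp: acceptable_def valid_def positive_rigid_vector_def positive_rigid_def node)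
  qed
  have card3: "card (visited 0 c) = 3"
    using c by (simp add: polygon_colorings_def path_colorings_def)
  show "X \<in> orbit ` ?P"
  proof (cases "derived_sign \<chi> []")
    case Plus
    from positive[OF t this card3] show ?thesis by (auto simp: X)
  next
    case Minus
    let ?\<pi> = "transpose color1 color2"
    have perm: "?\<pi> permutes {color1, color2, color3}" by (rule permutes_swap_id) auto
    have "derived_sign (\<lambda>v. ?\<pi> (\<chi> v)) [] = Plus"
      using derived_sign_swap_colors[OF t[unfolded node]] Minus
      by (cases "derived_sign (\<lambda>v. ?\<pi> (\<chi> v)) []") auto
    then have "map ?\<pi> c \<in> ?P"
      using card3
      by (intro positive[OF valid_coloring_color_perm[OF perm t]])
        (simp_all add: card_visited_map_color_perm[OF perm])
    then show ?thesis
      unfolding X orbit_map_color_perm[OF perm, symmetric, of c] by (rule imageI)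
  qed
qed

lemma num_flexible_polygons: "n \<ge> 1 \<Longrightarrow> 6 * num_flexible n = card (polygon_colorings (n + 1) 4)"
  using card_polygon_colorings_eq_orbits[of 4 "n + 1"]
  by (simp only: num_flexible_def flexible_vectors_eq)

lemma num_positive_rigid_polygons:
  "n \<ge> 1 \<Longrightarrow> 6 * num_positive_rigid n = card (polygon_colorings (n + 1) 3)"
  using card_polygon_colorings_eq_orbits[of 3 "n + 1"]
  by (simp only: num_positive_rigid_def orbits_positive_rigid_eq)

theorem lemma15p5:
  shows "num_flexible 1 = 0 \<and> num_flexible 2 = 1 \<and>
    (\<forall>n\<ge>1. num_flexible (n + 1) = 3 * num_flexible n + num_positive_rigid n)"
proof -
  have rec: "num_flexible (n + 1) = 3 * num_flexible n + num_positive_rigid n" if "n \<ge> 1" for n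
    using num_flexible_polygons[of n] num_flexible_polygons[of "n + 1"]
      num_positive_rigid_polygons[of n] card_polygon_colorings_rec[of "n + 1"] that
    by simp
  moreover have "num_flexible 1 = 0"
    using num_flexible_polygons[of 1] card_polygon_colorings_rec[of 1]
    by (simp add: card_polygon_colorings_1)
  moreover have "num_positive_rigid 1 = 1"
    using num_positive_rigid_polygons[of 1] card_polygon_colorings_2 by (simp add: numeral_2_eq_2)
  moreover have "num_flexible 2 = 3 * num_flexible 1 + num_positive_rigid 1"
    using rec[of 1] by (simp add: numeral_2_eq_2)
  ultimately show ?thesis by simp
qed

end
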